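(* Let $k$ be a field, let $I$ be a monomial ideal of $R=k[x_1,\ldots,x_n]$, and let $\mathcal{P}(I)$ be its polarization. If $\mathcal{P}(I)$ is the facet ideal of a simplicial tree and $\mathfrak{p}$ is a prime ideal of $R$ containing $I$, then $\mathcal{P}(I_{\mathfrak{p}})$ is the facet ideal of a simplicial forest.
   Context: Polarization: for a monomial $M=x_1^{a_1}\cdots x_n^{a_n}$ put $\mathcal{P}(M)=\prod_{i=1}^n\prod_{j=1}^{a_i}x_{i,j}$, a square-free monomial in a polynomial ring $S=k[x_{i,j}]$ with sufficiently many variables. For a monomial ideal $I=(M_1,\ldots,M_q)$ (generated by monomials $M_i$), $\mathcal{P}(I)=(\mathcal{P}(M_1),\ldots,\mathcal{P}(M_q))\subseteq S$. Localization convention: $I_{\mathfrak p}$ is identified with the monomial ideal of a polynomial ring generated by the monomials $M_1',\ldots,M_q'$, where $M_i'$ is obtained from $M_i$ by dividing out all powers of those variables $x_j$ with $x_j\notin\mathfrak p$ (equivalently, setting these variables equal to $1$). Its polarization is taken as a monomial ideal. Facet ideals: a simplicial complex $\Delta$ is a collection of subsets (faces) of a finite vertex set, closed under taking subsets and containing all singletons of vertices; facets are its maximal faces. Vertices are identified with variables of a polynomial ring, and the facet ideal $\mathcal{F}(\Delta)$ is the ideal generated by the square-free monomials $\prod_{v\in F}v$, $F$ a facet of $\Delta$. A subcollection of $\Delta$ is a simplicial complex whose facet set is a subset of the facet set of $\Delta$. Trees: a facet $F$ of $\Delta$ is a leaf if either $F$ is the only facet of $\Delta$, or there is a facet $G\neq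 F$ of $\Delta$ such that $F\cap H\subseteq G$ for every facet $H\ne F$ of $\Delta$. $\Delta$ is connected if any two facets can be joined by a sequence of facets in which consecutive ones intersect. $\Delta$ is a forest if every nonempty subcollection of $\Delta$ has a leaf; a tree is a connected forest. *)

theory Defs
  imports "HOL-Library.Poly_Mapping" "HOL-Algebra.Algebraic_Closure_Type"
begin

section \<open>Polynomial rings and monomial ideals\<close>

text \<open>
  A polynomial over \<open>'k\<close> in variables indexed by \<open>'v\<close> is a finitely supported function from
  finitely supported exponent vectors to coefficients; multiplication is convolution.
\<close>

type_synonym ('v, 'k) mpoly = "('v \<Rightarrow>\<^sub>0 nat) \<Rightarrow>\<^sub>0 'k"

definition var :: "'v \<Rightarrow> ('v, 'k::comm_ring_1) mpoly" where
  "var v = Poly_Mapping.single (Poly_Mapping.single v 1) 1"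

definition ideal_gen :: "'r::comm_ring_1 set \<Rightarrow> 'r set" where
  "ideal_gen G = Idl\<^bsub>ring_of_type_algebra\<^esub> G"

definition prime_ideal :: "'r::comm_ring_1 set \<Rightarrow> bool" where
  "prime_ideal p \<longleftrightarrow> primeideal p ring_of_type_algebra"

text \<open>
  The variables of \<open>R = k[x\<^sub>1, \<dots>, x\<^sub>n]\<close> are indexed by a finite type \<open>'n\<close>; a monomial of \<open>R\<close> is given
  by its exponents \<open>a :: 'n \<Rightarrow> nat\<close>.
\<close>

definition monomial :: "('n::finite \<Rightarrow> nat) \<Rightarrow> ('n, 'k::comm_ring_1) mpoly" where
  "monomial a = (\<Prod>i\<in>UNIV. var i ^ a i)"

definition monomial_ideal :: "('n::finite, 'k::comm_ring_1) mpoly set \<Rightarrow> bool" where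
  "monomial_ideal I \<longleftrightarrow> (\<exists>A. finite A \<and> I = ideal_gen (monomial ` A))"

section \<open>Polarization and localization\<close>

text \<open>
  The polarization lives in the polynomial ring in the variables \<open>x\<^sub>i\<^sub>,\<^sub>j\<close> for \<open>(i, j) :: 'n \<times> nat\<close>.
  There are infinitely many of them, which serves as ``sufficiently many''; only those with
  \<open>j \<ge> 1\<close> occur in polarizations.
\<close>

definition polarize_monomial :: "('n::finite \<Rightarrow> nat) \<Rightarrow> ('n \<times> nat, 'k::comm_ring_1) mpoly" where
  "polarize_monomial a = (\<Prod>i\<in>UNIV. \<Prod>j=1..a i. var (i, j))"

text \<open>
  The following two operations on a monomial ideal are given by a finite system of monomial
  generators. The result does not depend on the chosen system; see \<open>polarization_ideal_gen\<close>
  and \<open>localization_ideal_gen\<close> below.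
\<close>

definition polarization ::
  "('n::finite, 'k::comm_ring_1) mpoly set \<Rightarrow> ('n \<times> nat, 'k) mpoly set" where
  "polarization I = (THE J. \<exists>A. finite A \<and> I = ideal_gen (monomial ` A) \<and>
     J = ideal_gen (polarize_monomial ` A))"

text \<open>
  \<open>localize_exponents p a\<close> divides the monomial with exponents \<open>a\<close> by all powers of the variables
  outside \<open>p\<close>. The localization \<open>I\<^sub>p\<close> is identified with the monomial ideal generated by the resulting
  monomials. They involve only variables in \<open>p\<close>, but the ideal is again taken in \<open>R\<close>.
\<close>

definition localize_exponents ::
  "('n, 'k::comm_ring_1) mpoly set \<Rightarrow> ('n \<Rightarrow> nat) \<Rightarrow> ('n \<Rightarrow> nat)" where
  "localize_exponents p a = (\<lambda>i. if var i \<in> p then a i else 0)"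

definition localization ::
  "('n::finite, 'k::comm_ring_1) mpoly set \<Rightarrow> ('n, 'k) mpoly set \<Rightarrow> ('n, 'k) mpoly set" where
  "localization p I = (THE J. \<exists>A. finite A \<and> I = ideal_gen (monomial ` A) \<and>
     J = ideal_gen (monomial ` localize_exponents p ` A))"

section \<open>Simplicial complexes, facet ideals, trees and forests\<close>

definition simplicial_complex :: "'v set \<Rightarrow> 'v set set \<Rightarrow> bool" where
  "simplicial_complex V \<Delta> \<longleftrightarrow>
     finite V \<and> (\<forall>F\<in>\<Delta>. F \<subseteq> V) \<and> (\<forall>F\<in>\<Delta>. \<forall>G\<subseteq>F. G \<in> \<Delta>) \<and> (\<forall>v\<in>V. {v} \<in> \<Delta>)"

definition facets :: "'v set set \<Rightarrow> 'v set set" where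
  "facets \<Delta> = {F \<in> \<Delta>. \<forall>G\<in>\<Delta>. F \<subseteq> G \<longrightarrow> G = F}"

text \<open>The vertices of the complex are the variables (or rather, their indices).\<close>

definition facet_ideal :: "'v set set \<Rightarrow> ('v, 'k::comm_ring_1) mpoly set" where
  "facet_ideal \<Delta> = ideal_gen ((\<lambda>F. \<Prod>v\<in>F. var v) ` facets \<Delta>)"

text \<open>The vertex set of a subcollection may be smaller than that of the ambient complex.\<close>

definition subcollection :: "'v set set \<Rightarrow> 'v set set \<Rightarrow> bool" where
  "subcollection \<Gamma> \<Delta> \<longleftrightarrow> (\<exists>W. simplicial_complex W \<Gamma>) \<and> facets \<Gamma> \<subseteq> facets \<Delta>"

definition leaf :: "'v set set \<Rightarrow> 'v set \<Rightarrow> bool" where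
  "leaf \<Delta> F \<longleftrightarrow> F \<in> facets \<Delta> \<and>
     (facets \<Delta> = {F} \<or>
      (\<exists>G\<in>facets \<Delta>. G \<noteq> F \<and> (\<forall>H\<in>facets \<Delta>. H \<noteq> F \<longrightarrow> F \<inter> H \<subseteq> G)))"

definition connected_complex :: "'v set set \<Rightarrow> bool" where
  "connected_complex \<Delta> \<longleftrightarrow> (\<forall>F\<in>facets \<Delta>. \<forall>G\<in>facets \<Delta>.
     (F, G) \<in> {(A, B). A \<in> facets \<Delta> \<and> B \<in> facets \<Delta> \<and> A \<inter> B \<noteq> {}}\<^sup>*)"

definition simplicial_forest :: "'v set \<Rightarrow> 'v set set \<Rightarrow> bool" where
  "simplicial_forest V \<Delta> \<longleftrightarrow> simplicial_complex V \<Delta> \<and>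
     (\<forall>\<Gamma>. subcollection \<Gamma> \<Delta> \<and> \<Gamma> \<noteq> {} \<longrightarrow> (\<exists>F. leaf \<Gamma> F))"

definition simplicial_tree :: "'v set \<Rightarrow> 'v set set \<Rightarrow> bool" where
  "simplicial_tree V \<Delta> \<longleftrightarrow> simplicial_forest V \<Delta> \<and> connected_complex \<Delta>"

section \<open>Independence of the generators\<close>

lemma ideal_type_iff:
  fixes I :: "'r::comm_ring_1 set"
  shows "ideal I ring_of_type_algebra \<longleftrightarrow>
    0 \<in> I \<and> (\<forall>x\<in>I. \<forall>y\<in>I. x + y \<in> I) \<and> (\<forall>x. \<forall>y\<in>I. x * y \<in> I)" (is "_ \<longleftrightarrow> ?R")
proof
  let ?T = "ring_of_type_algebra :: 'r ring"
  assume "ideal I ?T"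
  then interpret ideal I ?T .
  show ?R
    using additive_subgroup.zero_closed[OF is_additive_subgroup]
      additive_subgroup.a_closed[OF is_additive_subgroup] I_l_closed
    by (auto simp: ring_of_type_algebra_def)
next
  let ?T = "ring_of_type_algebra :: 'r ring"
  assume R: ?R
  interpret cring ?T by (rule cring_from_type_algebra)
  have inv: "inv\<^bsub>add_monoid ?T\<^esub> x = - x" for x
    using minus_equality[of "- x" x] unfolding a_inv_def
    by (simp add: ring_of_type_algebra_def)
  have neg: "- x \<in> I" if "x \<in> I" for x
    using R that by (metis mult_minus1)
  have right: "x * y \<in> I" if "x \<in> I" for x y
    using R that by (metis mult.commute)
  show "ideal I ?T"
  proof (rule idealI)
    show "ring ?T" by (rule ring_axioms)
    show "subgroup I (add_monoid ?T)"
      using R neg inv by unfold_locales (auto simp: ring_of_type_algebra_def)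
  qed (use R right in \<open>auto simp: ring_of_type_algebra_def\<close>)
qed

lemma ideal_ideal_gen:
  fixes G :: "'r::comm_ring_1 set"
  shows "ideal (ideal_gen G) ring_of_type_algebra"
proof -
  interpret ring "ring_of_type_algebra :: 'r ring" by (rule ring_from_type_algebra)
  show ?thesis
    unfolding ideal_gen_def by (rule genideal_ideal) (simp add: ring_of_type_algebra_def)
qed

lemma ideal_gen_superset: "G \<subseteq> ideal_gen G"
  unfolding ideal_gen_def genideal_def by blast

lemma ideal_gen_least: "ideal I ring_of_type_algebra \<Longrightarrow> G \<subseteq> I \<Longrightarrow> ideal_gen G \<subseteq> I"
  unfolding ideal_gen_def genideal_def by blast

lemma ideal_gen_mono_dvd:
  assumes "\<And>x. x \<in> G \<Longrightarrow> \<exists>y\<in>H. y dvd x"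
  shows "ideal_gen G \<subseteq> ideal_gen H"
proof (rule ideal_gen_least[OF ideal_ideal_gen])
  show "G \<subseteq> ideal_gen H"
    using assms ideal_gen_superset[of H] ideal_ideal_gen[of H, unfolded ideal_type_iff]
    by (metis dvd_def mult.commute subset_iff)
qed

lemma prod_single:
  "finite A \<Longrightarrow> (\<Prod>i\<in>A. Poly_Mapping.single (f i) (1::'k::comm_ring_1)) = Poly_Mapping.single (\<Sum>i\<in>A. f i) 1"
  by (induction A rule: finite_induct) (auto simp: mult_single)

lemma var_power:
  "(var i ^ m :: ('v, 'k::comm_ring_1) mpoly) = Poly_Mapping.single (Poly_Mapping.single i m) 1"
  by (induction m) (auto simp: var_def mult_single simp flip: single_add)

lemma monomial_eq_single:
  fixes a :: "'n::finite \<Rightarrow> nat"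
  shows "monomial a = Poly_Mapping.single (\<Sum>i\<in>UNIV. Poly_Mapping.single i (a i)) (1::'k::comm_ring_1)"
  unfolding monomial_def var_power by (rule prod_single) simp

lemma lookup_exponent:
  fixes a :: "'n::finite \<Rightarrow> nat"
  shows "Poly_Mapping.lookup (\<Sum>i\<in>UNIV. Poly_Mapping.single i (a i)) j = a j"
  by (simp add: lookup_sum lookup_single when_def)

lemma monomial_in_ideal_gen:
  fixes A :: "('n::finite \<Rightarrow> nat) set"
  assumes "(monomial a :: ('n, 'k::comm_ring_1) mpoly) \<in> ideal_gen (monomial ` A)"
  shows "\<exists>b\<in>A. b \<le> a"
proof -
  define K :: "('n, 'k) mpoly set" where "K = {f. \<forall>e\<in>Poly_Mapping.keys f. \<exists>b\<in>A. b \<le> Poly_Mapping.lookup e}"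
  have "ideal K ring_of_type_algebra"
    unfolding ideal_type_iff
  proof (intro conjI ballI allI)
    show "0 \<in> K" by (simp add: K_def)
    show "x + y \<in> K" if "x \<in> K" "y \<in> K" for x y
      using that keys_add[of x y] by (auto simp: K_def)
    show "x * y \<in> K" if y: "y \<in> K" for x y
      unfolding K_def
    proof safe
      fix e assume "e \<in> Poly_Mapping.keys (x * y)"
      then obtain c d where e: "e = c + d" "d \<in> Poly_Mapping.keys y" using keys_mult[of x y] by auto
      then obtain b where "b \<in> A" "b \<le> Poly_Mapping.lookup d" using y by (auto simp: K_def)
      then show "\<exists>b\<in>A. b \<le> Poly_Mapping.lookup e"
        using e by (auto simp: le_fun_def lookup_add intro!: bexI[of _ b] intro: trans_le_add2)
    qed
  qed
  moreover have "monomial ` A \<subseteq> K"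
    by (auto simp: K_def monomial_eq_single lookup_exponent le_fun_def)
  ultimately have "monomial a \<in> K" using assms ideal_gen_least by blast
  then show ?thesis by (auto simp: K_def monomial_eq_single lookup_exponent le_fun_def)
qed

lemma ideal_gen_transfer:
  fixes A B :: "('n::finite \<Rightarrow> nat) set" and h :: "('n \<Rightarrow> nat) \<Rightarrow> 'r::comm_ring_1"
  assumes "(ideal_gen (monomial ` A) :: ('n, 'k::comm_ring_1) mpoly set) = ideal_gen (monomial ` B)"
    and "\<And>a b. b \<le> a \<Longrightarrow> h b dvd h a"
  shows "ideal_gen (h ` A) = ideal_gen (h ` B)"
proof -
  have "ideal_gen (h ` A) \<subseteq> ideal_gen (h ` B)"
    if "(ideal_gen (monomial ` A) :: ('n, 'k) mpoly set) = ideal_gen (monomial ` B)" for A B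
  proof (rule ideal_gen_mono_dvd)
    fix x assume "x \<in> h ` A"
    then obtain a where a: "a \<in> A" "x = h a" by auto
    then have "(monomial a :: ('n, 'k) mpoly) \<in> ideal_gen (monomial ` B)"
      using ideal_gen_superset[of "monomial ` A :: ('n, 'k) mpoly set"] that by auto
    from monomial_in_ideal_gen[OF this] show "\<exists>y\<in>h ` B. y dvd x"
      using assms(2) a by auto
  qed
  with assms(1) show ?thesis by (metis subset_antisym)
qed

lemma polarization_ideal_gen:
  assumes "finite A"
  shows "polarization (ideal_gen (monomial ` A) :: ('n::finite, 'k::comm_ring_1) mpoly set) =
    ideal_gen (polarize_monomial ` A)"
proof -
  have dvd: "(polarize_monomial b :: ('n \<times> nat, 'k) mpoly) dvd polarize_monomial a"
    if "b \<le> a" for a b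
    unfolding polarize_monomial_def
  proof (rule prod_dvd_prod)
    fix i
    have "b i \<le> a i" using that by (simp add: le_fun_def)
    then show "(\<Prod>j=1..b i. var (i, j) :: ('n \<times> nat, 'k) mpoly) dvd (\<Prod>j=1..a i. var (i, j))"
      by (intro prod_dvd_prod_subset) auto
  qed
  show ?thesis
    unfolding polarization_def
  proof (rule the_equality)
    show "\<exists>B. finite B \<and>
        (ideal_gen (monomial ` A) :: ('n, 'k) mpoly set) = ideal_gen (monomial ` B) \<and>
        (ideal_gen (polarize_monomial ` A) :: ('n \<times> nat, 'k) mpoly set) =
          ideal_gen (polarize_monomial ` B)"
      using assms by blast
  next
    fix J :: "('n \<times> nat, 'k) mpoly set"
    assume "\<exists>B. finite B \<and>
        (ideal_gen (monomial ` A) :: ('n, 'k) mpoly set) = ideal_gen (monomial ` B) \<and>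
        J = ideal_gen (polarize_monomial ` B)"
    then obtain B where
      B: "(ideal_gen (monomial ` A) :: ('n, 'k) mpoly set) = ideal_gen (monomial ` B)"
      and J: "J = ideal_gen (polarize_monomial ` B)"
      by blast
    show "J = ideal_gen (polarize_monomial ` A)"
      unfolding J by (rule ideal_gen_transfer[OF B dvd, symmetric])
  qed
qed

lemma localization_ideal_gen:
  assumes "finite A"
  shows "localization p (ideal_gen (monomial ` A) :: ('n::finite, 'k::comm_ring_1) mpoly set) =
    ideal_gen (monomial ` localize_exponents p ` A)"
proof -
  have dvd: "(monomial (localize_exponents p b) :: ('n, 'k) mpoly) dvd
      monomial (localize_exponents p a)" if "b \<le> a" for a b
    unfolding monomial_def
  proof (rule prod_dvd_prod)
    fix i
    have "localize_exponents p b i \<le> localize_exponents p a i"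
      using that by (simp add: le_fun_def localize_exponents_def)
    then show "(var i ^ localize_exponents p b i :: ('n, 'k) mpoly) dvd
        var i ^ localize_exponents p a i"
      by (rule le_imp_power_dvd)
  qed
  show ?thesis
    unfolding localization_def image_image
  proof (rule the_equality)
    show "\<exists>B. finite B \<and>
        (ideal_gen (monomial ` A) :: ('n, 'k) mpoly set) = ideal_gen (monomial ` B) \<and>
        (ideal_gen ((\<lambda>a. monomial (localize_exponents p a)) ` A) :: ('n, 'k) mpoly set) =
          ideal_gen ((\<lambda>a. monomial (localize_exponents p a)) ` B)"
      using assms by blast
  next
    fix J :: "('n, 'k) mpoly set"
    assume "\<exists>B. finite B \<and>
        (ideal_gen (monomial ` A) :: ('n, 'k) mpoly set) = ideal_gen (monomial ` B) \<and>
        J = ideal_gen ((\<lambda>a. monomial (localize_exponents p a)) ` B)"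
    then obtain B where
      B: "(ideal_gen (monomial ` A) :: ('n, 'k) mpoly set) = ideal_gen (monomial ` B)"
      and J: "J = ideal_gen ((\<lambda>a. monomial (localize_exponents p a)) ` B)"
      by blast
    show "J = ideal_gen ((\<lambda>a. monomial (localize_exponents p a)) ` A)"
      unfolding J by (rule ideal_gen_transfer[OF B dvd, symmetric])
  qed
qed

end

theory Submission
  imports Defs
begin

text \<open>
  Polarization turns setting variables equal to 1 into intersecting every facet with the set \<open>W\<close> of
  the variables \<open>x\<^sub>i\<^sub>,\<^sub>j\<close> with \<open>x\<^sub>i \<in> \<pp>\<close>. The minimal generators of the localization are therefore
  distinct sets \<open>F \<inter> W\<close> with \<open>F\<close> a facet of the tree. Lifting a set of such generators to facets
  of the tree yields a subcollection, whose leaf \<open>F\<close> and joint \<open>G\<close> satisfy \<open>F \<inter> H \<subseteq> G\<close> for all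
  other facets \<open>H\<close>; intersecting with \<open>W\<close> preserves these inclusions.
\<close>

section \<open>Complexes given by their facet sets\<close>

definition antichain :: "'v set set \<Rightarrow> bool" where
  "antichain M \<longleftrightarrow> (\<forall>F\<in>M. \<forall>G\<in>M. F \<subseteq> G \<longrightarrow> F = G)"

text \<open>Used to turn a family of minimal generators back into a complex. The empty family gives
  the complex without faces, whose facet ideal is zero.\<close>

definition generated_complex :: "'v set set \<Rightarrow> 'v set set" where
  "generated_complex M = {F. \<exists>G\<in>M. F \<subseteq> G}"

text \<open>A square-free monomial is determined by its variables, so divisibility of polarized
  monomials can be handled as inclusion of finite sets.\<close>

definition polarization_support :: "('n \<Rightarrow> nat) \<Rightarrow> ('n \<times> nat) set" where
  "polarization_support a = (SIGMA i:UNIV. {1..a i})"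

lemma antichain_subset: "antichain M \<Longrightarrow> N \<subseteq> M \<Longrightarrow> antichain N"
  unfolding antichain_def by blast

lemma antichain_facets: "antichain (facets \<Delta>)"
  unfolding antichain_def facets_def by blast

text \<open>A face above \<open>F\<close> in \<open>M\<close> lies below some \<open>H\<close> in
  \<open>M\<close>, and incomparability squeezes it to \<open>F\<close>.\<close>

lemma facets_generated_complex:
  assumes "antichain M"
  shows "facets (generated_complex M) = M"
proof
  show "facets (generated_complex M) \<subseteq> M"
    unfolding facets_def generated_complex_def by blast
  show "M \<subseteq> facets (generated_complex M)"
  proof
    fix F assume F: "F \<in> M"
    have "G = F" if "F \<subseteq> G" "G \<subseteq> H" "H \<in> M" for G H
      using assms F that unfolding antichain_def by blast
    then show "F \<in> facets (generated_complex M)"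
      using F unfolding facets_def generated_complex_def by blast
  qed
qed

lemma simplicial_complex_generated:
  assumes "finite M" "\<And>F. F \<in> M \<Longrightarrow> finite F"
  shows "simplicial_complex (\<Union>M) (generated_complex M)"
  using assms unfolding simplicial_complex_def generated_complex_def
  by (auto intro: order_trans)

lemma finite_simplicial_complex:
  assumes "simplicial_complex V \<Delta>"
  shows "finite \<Delta>"
  by (rule finite_subset[of _ "Pow V"]) (use assms in \<open>auto simp: simplicial_complex_def\<close>)

lemma finite_face:
  assumes "simplicial_complex V \<Delta>" "F \<in> \<Delta>"
  shows "finite F"
  using assms unfolding simplicial_complex_def by (meson finite_subset)

lemma finite_facets:
  assumes "simplicial_complex V \<Delta>"
  shows "finite (facets \<Delta>)"
  using finite_simplicial_complex[OF assms] by (simp add: facets_def)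

lemma facets_nonempty:
  assumes "simplicial_complex V \<Delta>" "\<Delta> \<noteq> {}"
  shows "facets \<Delta> \<noteq> {}"
proof -
  from assms finite_simplicial_complex obtain F where "F \<in> \<Delta>" "\<forall>G\<in>\<Delta>. F \<subseteq> G \<longrightarrow> F = G"
    by (metis finite_has_maximal)
  then show ?thesis unfolding facets_def by blast
qed

text \<open>Facets may have equal or nested traces on \<open>W\<close>, so \<open>M\<close> is an
  incomparable family of traces; its members are then exactly the facets of the complex it
  generates.\<close>

lemma simplicial_forest_restrict:
  assumes forest: "simplicial_forest V \<Delta>"
    and M: "M \<subseteq> (\<lambda>F. F \<inter> W) ` facets \<Delta>"
    and anti: "antichain M"
  shows "simplicial_forest (\<Union>M) (generated_complex M)"
  unfolding simplicial_forest_def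
proof (intro conjI allI impI)
  have cx: "simplicial_complex V \<Delta>"
    using forest by (simp add: simplicial_forest_def)
  have fin: "finite (facets \<Delta>)" "\<And>F. F \<in> facets \<Delta> \<Longrightarrow> finite F"
    using finite_facets[OF cx] finite_face[OF cx] by (auto simp: facets_def)
  have "finite M"
    using M fin(1) by (meson finite_imageI finite_subset)
  then show "simplicial_complex (\<Union>M) (generated_complex M)"
    by (rule simplicial_complex_generated) (use M fin(2) in auto)
  fix \<Gamma> assume \<Gamma>: "subcollection \<Gamma> (generated_complex M) \<and> \<Gamma> \<noteq> {}"
  let ?N = "facets \<Gamma>"
  have N: "?N \<subseteq> M" "?N \<noteq> {}"
    using \<Gamma> facets_nonempty facets_generated_complex[OF anti]
    unfolding subcollection_def by blast+
  have "\<exists>F\<in>facets \<Delta>. F \<inter> W = A" if "A \<in> M" for A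
    using M that by auto
  \<comment> \<open>One facet of \<Delta> is chosen over each trace; any choice works.\<close>
  then obtain g where g: "\<And>A. A \<in> M \<Longrightarrow> g A \<in> facets \<Delta>" "\<And>A. A \<in> M \<Longrightarrow> g A \<inter> W = A"
    by metis
  let ?L = "g ` ?N"
  have L: "?L \<subseteq> facets \<Delta>"
    using g(1) N(1) by blast
  \<comment> \<open>Any set of facets of \<Delta> is again an antichain, so the lifts span a
    subcollection of \<Delta>.\<close>
  have facets_L: "facets (generated_complex ?L) = ?L"
    by (rule facets_generated_complex[OF antichain_subset[OF antichain_facets L]])
  have "simplicial_complex (\<Union>?L) (generated_complex ?L)"
    by (rule simplicial_complex_generated) (use L fin in \<open>auto intro: finite_subset\<close>)
  then have "subcollection (generated_complex ?L) \<Delta>"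
    unfolding subcollection_def facets_L using L by blast
  moreover have "generated_complex ?L \<noteq> {}"
    using N(2) unfolding generated_complex_def by blast
  ultimately obtain F where "leaf (generated_complex ?L) F"
    using forest unfolding simplicial_forest_def by blast
  then have F: "F \<in> ?L" and joint: "?L = {F} \<or>
      (\<exists>G\<in>?L. G \<noteq> F \<and> (\<forall>H\<in>?L. H \<noteq> F \<longrightarrow> F \<inter> H \<subseteq> G))"
    unfolding leaf_def facets_L by auto
  from F obtain A where A: "A \<in> ?N" "F = g A" by blast
  \<comment> \<open>Intersecting with \<open>W\<close> undoes \<open>g\<close>, so distinct facets
    of \<Gamma> have distinct lifts.\<close>
  have inj: "g B = g C \<longleftrightarrow> B = C" if "B \<in> ?N" "C \<in> ?N" for B C
    using g(2) N(1) that by (metis subsetD)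
  have "leaf \<Gamma> A"
    unfolding leaf_def
  proof (intro conjI A(1))
    from joint show "?N = {A} \<or> (\<exists>G\<in>?N. G \<noteq> A \<and> (\<forall>H\<in>?N. H \<noteq> A \<longrightarrow> A \<inter> H \<subseteq> G))"
    proof
      assume "?L = {F}"
      have "B = A" if "B \<in> ?N" for B
      proof -
        have "g B = g A" using \<open>?L = {F}\<close> A(2) that by blast
        then show ?thesis using inj[OF that A(1)] by simp
      qed
      then have "?N = {A}" using A(1) by blast
      then show ?thesis ..
    next
      assume "\<exists>G\<in>?L. G \<noteq> F \<and> (\<forall>H\<in>?L. H \<noteq> F \<longrightarrow> F \<inter> H \<subseteq> G)"
      then obtain B where B: "B \<in> ?N" "g B \<noteq> F" "\<And>C. C \<in> ?N \<Longrightarrow> g C \<noteq> F \<Longrightarrow> F \<inter> g C \<subseteq> g B"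
        by auto
      have "A \<inter> C \<subseteq> B" if "C \<in> ?N" "C \<noteq> A" for C
      proof -
        \<comment> \<open>This is the joint inclusion \<open>F \<inter> g C \<subseteq> g B\<close>
          cut down to \<open>W\<close>.\<close>
        have "(g A \<inter> W) \<inter> (g C \<inter> W) \<subseteq> g B \<inter> W"
          using B(3)[of C] that inj A by blast
        moreover have "A \<in> M" "B \<in> M" "C \<in> M"
          using A B that N(1) by auto
        ultimately show ?thesis by (simp add: g(2))
      qed
      moreover have "B \<noteq> A" using A(2) B(2) by blast
      ultimately show ?thesis using B(1) by blast
    qed
  qed
  then show "\<exists>F. leaf \<Gamma> F" ..
qed

section \<open>Membership in square-free monomial ideals\<close>

lemma prod_var_eq_single:
  assumes "finite F"
  shows "(\<Prod>v\<in>F. var v) = Poly_Mapping.single (\<Sum>v\<in>F. Poly_Mapping.single v 1) (1::'k::comm_ring_1)"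
  unfolding var_def by (rule prod_single[OF assms])

lemma lookup_sum_single:
  assumes "finite F"
  shows "Poly_Mapping.lookup (\<Sum>v\<in>F. Poly_Mapping.single v (1::nat)) w = (if w \<in> F then 1 else 0)"
  using assms by (simp add: lookup_sum lookup_single when_def)

text \<open>The polynomials \<open>K\<close> whose exponent vectors all have support containing a
  member of \<open>\<G>\<close> form an ideal with all generators in it. Recording supports is
  enough for square-free monomials, and the set of variables may be infinite.\<close>

lemma prod_var_in_ideal_gen:
  assumes fin: "finite F" "\<And>G. G \<in> \<G> \<Longrightarrow> finite G"
    and mem: "((\<Prod>v\<in>F. var v) :: ('v, 'k::comm_ring_1) mpoly) \<in> ideal_gen ((\<lambda>G. \<Prod>v\<in>G. var v) ` \<G>)"
  shows "\<exists>G\<in>\<G>. G \<subseteq> F"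
proof -
  define K :: "('v, 'k) mpoly set"
    where "K = {f. \<forall>e\<in>Poly_Mapping.keys f. \<exists>G\<in>\<G>. G \<subseteq> Poly_Mapping.keys e}"
  have keys_prod: "Poly_Mapping.keys (\<Sum>v\<in>G. Poly_Mapping.single v (1::nat)) = G"
    if "finite G" for G :: "'v set"
    by (rule Set.set_eqI) (simp add: in_keys_iff lookup_sum_single[OF that] del: One_nat_def)
  have "ideal K ring_of_type_algebra"
    unfolding ideal_type_iff
  proof (intro conjI ballI allI)
    show "0 \<in> K" by (simp add: K_def)
    show "x + y \<in> K" if "x \<in> K" "y \<in> K" for x y
      using that keys_add[of x y] by (auto simp: K_def)
    show "x * y \<in> K" if y: "y \<in> K" for x y
      unfolding K_def
    proof safe
      fix e assume "e \<in> Poly_Mapping.keys (x * y)"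
      then obtain c d where e: "e = c + d" "d \<in> Poly_Mapping.keys y"
        using keys_mult[of x y] by auto
      then obtain G where "G \<in> \<G>" "G \<subseteq> Poly_Mapping.keys d"
        using y by (auto simp: K_def)
      \<comment> \<open>Exponents are natural numbers, so nothing cancels in \<open>c + d\<close>
        and supports only grow.\<close>
      moreover have "Poly_Mapping.keys d \<subseteq> Poly_Mapping.keys e"
        using e by (auto simp: in_keys_iff lookup_add)
      ultimately show "\<exists>G\<in>\<G>. G \<subseteq> Poly_Mapping.keys e" by blast
    qed
  qed
  moreover have "(\<lambda>G. \<Prod>v\<in>G. var v) ` \<G> \<subseteq> K"
    using fin(2) by (auto simp: K_def prod_var_eq_single keys_prod simp del: One_nat_def)
  ultimately have "(\<Prod>v\<in>F. var v) \<in> K"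
    using mem ideal_gen_least by blast
  then show ?thesis
    using fin(1) by (simp add: K_def prod_var_eq_single keys_prod del: One_nat_def)
qed

text \<open>A subset of \<open>F\<close> gives a divisor of its monomial. Finiteness matters here
  because a product over an infinite set is 1 by default.\<close>

lemma ideal_gen_prod_var_mono:
  assumes "\<And>F. F \<in> \<F> \<Longrightarrow> finite F" "\<And>F. F \<in> \<F> \<Longrightarrow> \<exists>G\<in>\<G>. G \<subseteq> F"
  shows "(ideal_gen ((\<lambda>F. \<Prod>v\<in>F. var v) ` \<F>) :: ('v, 'k::comm_ring_1) mpoly set) \<subseteq>
    ideal_gen ((\<lambda>F. \<Prod>v\<in>F. var v) ` \<G>)"
proof (rule ideal_gen_mono_dvd)
  fix x :: "('v, 'k) mpoly" assume "x \<in> (\<lambda>F. \<Prod>v\<in>F. var v) ` \<F>"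
  then obtain F where F: "F \<in> \<F>" "x = (\<Prod>v\<in>F. var v)" by blast
  then obtain G where G: "G \<in> \<G>" "G \<subseteq> F" using assms(2) by blast
  then have "(\<Prod>v\<in>G. var v) dvd x"
    unfolding F(2) by (intro prod_dvd_prod_subset assms(1)[OF F(1)])
  then show "\<exists>y\<in>(\<lambda>F. \<Prod>v\<in>F. var v) ` \<G>. y dvd x" using G(1) by blast
qed

section \<open>Polarized monomials as sets of variables\<close>

lemma finite_polarization_support: "finite (polarization_support (a :: 'n::finite \<Rightarrow> nat))"
  by (simp add: polarization_support_def)

lemma polarize_monomial_eq_prod: "polarize_monomial a = (\<Prod>v\<in>polarization_support a. var v)"
  unfolding polarize_monomial_def polarization_support_def by (subst prod.Sigma) auto

text \<open>Each column \<open>i\<close> is either kept whole or emptied, the interval from 1 to 0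
  being empty.\<close>

lemma polarization_support_localize:
  "polarization_support (localize_exponents p a) = polarization_support a \<inter> {i. var i \<in> p} \<times> UNIV"
  by (auto simp: polarization_support_def localize_exponents_def split: if_splits)

theorem theorem4p1:
  fixes I p :: "('n::finite, 'k::field) mpoly set"
  assumes "monomial_ideal I"
    and "\<exists>V \<Delta>. simplicial_tree V \<Delta> \<and> polarization I = facet_ideal \<Delta>"
    and "prime_ideal p"
    and "I \<subseteq> p"
  shows "\<exists>V \<Delta>. simplicial_forest V \<Delta> \<and> polarization (localization p I) = facet_ideal \<Delta>"
proof -
  let ?gen = "\<lambda>\<F>. ideal_gen ((\<lambda>F. \<Prod>v\<in>F. var v) ` \<F>) :: ('n \<times> nat, 'k) mpoly set"
  let ?S = "polarization_support :: ('n \<Rightarrow> nat) \<Rightarrow> _"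
  obtain A where A: "finite A" "I = ideal_gen (monomial ` A)"
    using assms(1) unfolding monomial_ideal_def by blast
  obtain V \<Delta> where forest: "simplicial_forest V \<Delta>" and eq: "polarization I = facet_ideal \<Delta>"
    using assms(2) unfolding simplicial_tree_def by blast
  let ?T = "facets \<Delta>"
  have cx: "simplicial_complex V \<Delta>"
    using forest by (simp add: simplicial_forest_def)
  have fin: "finite F" if "F \<in> ?T" for F
    using finite_face[OF cx] that by (auto simp: facets_def)
  have polarization_gen:
    "polarization (ideal_gen (monomial ` B) :: ('n, 'k) mpoly set) = ?gen (?S ` B)"
    if "finite B" for B
    unfolding polarization_ideal_gen[OF that] image_image polarize_monomial_eq_prod ..
  have gens: "?gen (?S ` A) = ?gen ?T"
    using eq unfolding A(2) polarization_gen[OF A(1)] facet_ideal_def .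
  have dom1: "\<exists>F\<in>?T. F \<subseteq> ?S a" if "a \<in> A" for a
  proof (rule prod_var_in_ideal_gen[OF finite_polarization_support fin])
    show "(\<Prod>v\<in>?S a. var v :: ('n \<times> nat, 'k) mpoly) \<in> ?gen ?T"
      unfolding gens[symmetric] by (rule subsetD[OF ideal_gen_superset]) (use that in blast)
  qed
  \<comment> \<open>Facets are the minimal generators, so every monomial generating system must
    contain them.\<close>
  have dom2: "\<exists>a\<in>A. ?S a = F" if F: "F \<in> ?T" for F
  proof -
    have "\<exists>G\<in>?S ` A. G \<subseteq> F"
    proof (rule prod_var_in_ideal_gen[OF fin[OF F]])
      show "(\<Prod>v\<in>F. var v :: ('n \<times> nat, 'k) mpoly) \<in> ?gen (?S ` A)"
        unfolding gens by (rule subsetD[OF ideal_gen_superset]) (use F in blast)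
    qed (auto simp: finite_polarization_support)
    then obtain a where a: "a \<in> A" "?S a \<subseteq> F" by blast
    moreover from dom1[OF a(1)] obtain G where "G \<in> ?T" "G \<subseteq> ?S a" by blast
    \<comment> \<open>The chain \<open>G \<subseteq> ?S a \<subseteq> F\<close> collapses, since
      both ends are facets.\<close>
    ultimately have "?S a = F"
      using antichain_facets[of \<Delta>] F unfolding antichain_def by blast
    with a(1) show ?thesis by blast
  qed
  define W :: "('n \<times> nat) set" where "W = {i. var i \<in> p} \<times> UNIV"
  let ?loc = "localize_exponents p"
  have S_loc: "?S (?loc a) = ?S a \<inter> W" for a
    unfolding W_def by (rule polarization_support_localize)
  define R where "R = (\<lambda>F. F \<inter> W) ` ?T"
  \<comment> \<open>Traces of incomparable facets can become nested; only the minimal ones can be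
    facets, and they generate the same ideal.\<close>
  define M where "M = {F \<in> R. \<forall>G\<in>R. G \<subseteq> F \<longrightarrow> G = F}"
  have "finite R"
    unfolding R_def using finite_facets[OF cx] by simp
  then have below: "\<exists>G\<in>M. G \<subseteq> F" if "F \<in> R" for F
    using finite_has_minimal2[of R F] that unfolding M_def by blast
  have anti: "antichain M"
    unfolding M_def antichain_def by blast
  have "M \<subseteq> (\<lambda>F. F \<inter> W) ` ?T"
    unfolding M_def R_def by blast
  then have "simplicial_forest (\<Union>M) (generated_complex M)"
    by (rule simplicial_forest_restrict[OF forest _ anti])
  moreover have "polarization (localization p I) = ?gen (?S ` ?loc ` A)"
    unfolding A(2) localization_ideal_gen[OF A(1)] polarization_gen[OF finite_imageI[OF A(1)]] ..
  moreover have "?gen (?S ` ?loc ` A) = ?gen M"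
  proof
    show "?gen (?S ` ?loc ` A) \<subseteq> ?gen M"
    proof (rule ideal_gen_prod_var_mono)
      fix F assume "F \<in> ?S ` ?loc ` A"
      then obtain a where a: "a \<in> A" "F = ?S a \<inter> W" by (auto simp: S_loc)
      show "finite F" by (simp add: a(2) finite_polarization_support)
      \<comment> \<open>Intersecting with \<open>W\<close> preserves inclusion, so a facet inside
        \<open>?S a\<close> has its trace inside \<open>F\<close>, and a minimal trace lies below
        that one.\<close>
      obtain G where "G \<in> ?T" "G \<subseteq> ?S a" using dom1[OF a(1)] by blast
      then have "G \<inter> W \<in> R" "G \<inter> W \<subseteq> F" by (auto simp: R_def a(2))
      then show "\<exists>G\<in>M. G \<subseteq> F" using below by (meson order_trans)
    qed
    show "?gen M \<subseteq> ?gen (?S ` ?loc ` A)"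
    proof (rule ideal_gen_prod_var_mono)
      fix F assume "F \<in> M"
      then obtain G where G: "G \<in> ?T" "F = G \<inter> W" by (auto simp: M_def R_def)
      then show "finite F" using fin by simp
      \<comment> \<open>The facet \<open>G\<close> is the support of an original generator, whose
        localization then has support exactly \<open>F\<close>.\<close>
      obtain a where "a \<in> A" "?S a = G" using dom2[OF G(1)] by blast
      then show "\<exists>G\<in>?S ` ?loc ` A. G \<subseteq> F" using G(2) S_loc by auto
    qed
  qed
  ultimately have "simplicial_forest (\<Union>M) (generated_complex M) \<and>
      polarization (localization p I) = facet_ideal (generated_complex M)"
    by (simp add: facet_ideal_def facets_generated_complex[OF anti])
  then show ?thesis by blast
qed

end
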